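(* Let $k<0$ or $0<k<1$, and let $M_{\widetilde C}$ be a global Maxwellian with $F(M_{\widetilde C})=\widetilde C$ (assumed to exist). Then the stationary solution $M_{\widetilde C}$ of the Fokker-Planck equation $$\frac{\partial f}{\partial t}=\Delta_v f-v\cdot\nabla_x f+\mathrm{div}_v\big(vf(1+kf)\big),\qquad x\in\Omega,\ v\in\mathbb{R}^n,$$ is locally stable (i.e. Lyapunov stable), with respect to the distance $\widetilde G(f)=F(M_{\widetilde C})-F(f)$, in the class of dissipative solutions $f$ (of class $C_0^1$) of this equation satisfying $f>0$, $1+kf>0$ and $U(f,\Omega)\le0$ for all $t$.
   Context: $\Omega\subset\mathbb{R}^n$ ($n\ge1$) is a bounded domain with boundary regular enough for the Gauss-Ostrogradsky formula, and $t$ ranges over the time interval in $\mathbb{R}$ on which $f$ is defined. For $k\ne0$ put $\Phi(f)=f\log f-\frac1k(1+kf)\log(1+kf)+f$ (with $0\log0=0$). Entropy: $S(f)(t)=-\int_\Omega\int_{\mathbb{R}^n}\Phi(f)\,dv\,dx$. Total energy: $E(f)(t)=\int_\Omega\int_{\mathbb{R}^n}\frac{|v|^2}{2}f\,dv\,dx$. Free energy: $F(f)=S(f)-E(f)$, i.e. $F(f)=\int_\Omega\int_{\mathbb{R}^n}\big(-\frac{|v|^2}{2}f-\Phi(f)\big)dv\,dx$. Global Maxwellians are the functions $\dfrac{Ce^{-|v|^2/2}}{1-kCe^{-|v|^2/2}}$ with constant $C>0$, $1-kC>0$; they are stationary solutions of the equation. $\widetilde C=\sup F(g)$, the supremum being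 over functions $g$ on $\Omega\times\mathbb{R}^n$ with $g\ge0$, $1+kg>0$ and $\frac12\int_{\mathbb{R}^n}|v|^2g\,dv<\infty$; it is finite for $k<0$ and for $0<k<1$. $\widetilde G(f)=\widetilde C-F(f)\ge0$, a function of $t$ on a solution, is regarded as the distance between $M_{\widetilde C}$ and $f$ at time $t$. Lyapunov stability of $M_{\widetilde C}$ in a class of solutions means: for every $\varepsilon>0$ there is $\delta>0$ such that for every $f$ in the class and every $t_0$, if $\widetilde G(f)<\delta$ at $t=t_0$ then $\widetilde G(f)<\varepsilon$ for all $t>t_0$. Energy flux: $A(f,\Omega)=\int_\Omega\int_{\mathbb{R}^n}\frac{|v|^2}{2}\,v\cdot\nabla_x f\,dv\,dx$. A solution $f$ is dissipative if $A(f,\Omega)\ge0$ for all $t$. Entropy flow: $U(f,\Omega)=-\int_\Omega\int_{\mathbb{R}^n}\big(\log\frac{f}{1+kf}+1\big)v\cdot\nabla_x f\,dv\,dx=-\int_\Omega\int_{\mathbb{R}^n}v\cdot\nabla_x\Phi(f)\,dv\,dx$. $C_0^1$ is the class of differentiable functions of $(x,v)$ tending to zero sufficiently rapidly as $v\to\infty$. As a standing assumption, $f$ is regular enough for the equation to make sense, and $f$ and $\partial f/\partial v_i$ decay so that all integrals above converge, $E$ and $S$ may be differentiated in $t$ under the integral sign, and the integration by parts in $v$ arising when the equation is multiplied by $\log\frac{f}{1+kf}+1+\frac{|v|^2}{2}$ and integrated over $\mathbb{R}^n\times\Omega$ produces no terms at infinity. *)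

theory Defs
  imports "HOL-Analysis.Analysis"
begin

section \<open>Differential operators on Euclidean space\<close>

definition partial_deriv :: "'n \<Rightarrow> (real ^ 'n \<Rightarrow> real) \<Rightarrow> real ^ 'n \<Rightarrow> real" where
  "partial_deriv i u p = deriv (\<lambda>s. u (p + s *\<^sub>R axis i 1)) 0"

definition grad :: "(real ^ 'n \<Rightarrow> real) \<Rightarrow> real ^ 'n \<Rightarrow> real ^ 'n" where
  "grad u p = (\<chi> i. partial_deriv i u p)"

definition divergence :: "(real ^ 'n \<Rightarrow> real ^ 'n) \<Rightarrow> real ^ 'n \<Rightarrow> real" where
  "divergence Y p = (\<Sum>i\<in>UNIV. partial_deriv i (\<lambda>q. Y q $ i) p)"

definition laplacian :: "(real ^ 'n \<Rightarrow> real) \<Rightarrow> real ^ 'n \<Rightarrow> real" where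
  "laplacian u = divergence (grad u)"

text \<open>
  The boundary of \<open>\<Omega>\<close> is regular enough for the Gauss-Ostrogradsky formula: there are a finite
  measure \<open>\<sigma>\<close> carried by the boundary and a field \<open>\<nu>\<close> of unit normals for which the formula holds
  for all continuously differentiable fields. The formula determines \<open>\<sigma>\<close>, and \<open>\<nu>\<close> up to a
  \<open>\<sigma>\<close>-null set; for a Lipschitz boundary they are the surface measure and the outer normal.
\<close>

definition gauss_regular :: "(real ^ 'n) set \<Rightarrow> bool" where
  "gauss_regular \<Omega> \<longleftrightarrow>
    (\<exists>(\<sigma> :: (real ^ 'n) measure) (\<nu> :: real ^ 'n \<Rightarrow> real ^ 'n).
       sets \<sigma> = sets borel \<and> finite_measure \<sigma> \<and> emeasure \<sigma> (- frontier \<Omega>) = 0 \<and>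
       \<nu> \<in> borel_measurable borel \<and> (\<forall>p\<in>frontier \<Omega>. norm (\<nu> p) = 1) \<and>
       (\<forall>(Y :: real ^ 'n \<Rightarrow> real ^ 'n) (Y' :: real ^ 'n \<Rightarrow> (real ^ 'n) \<Rightarrow>\<^sub>L (real ^ 'n)).
          (\<forall>p. (Y has_derivative blinfun_apply (Y' p)) (at p)) \<and> continuous_on UNIV Y' \<longrightarrow>
          (LINT p:\<Omega>|lborel. divergence Y p) = (LINT p|\<sigma>. Y p \<bullet> \<nu> p)))"


section \<open>Integrals over phase space\<close>

text \<open>
  Functions on \<open>\<Omega> \<times> \<real>\<^sup>n\<close> are curried, position first. Convergence of an integral over
  \<open>\<Omega> \<times> \<real>\<^sup>n\<close> is absolute convergence.
\<close>

definition phase_integral :: "(real ^ 'n) set \<Rightarrow> (real ^ 'n \<Rightarrow> real ^ 'n \<Rightarrow> real) \<Rightarrow> real" where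
  "phase_integral \<Omega> g = (LINT x:\<Omega>|lborel. (LINT v|lborel. g x v))"

definition phase_integrable :: "(real ^ 'n) set \<Rightarrow> (real ^ 'n \<Rightarrow> real ^ 'n \<Rightarrow> real) \<Rightarrow> bool" where
  "phase_integrable \<Omega> g \<longleftrightarrow> set_integrable lborel (\<Omega> \<times> UNIV) (\<lambda>(x, v). g x v)"


section \<open>Entropy, energy and free energy\<close>

text \<open>Since \<open>ln 0 = 0\<close>, the convention \<open>0 log 0 = 0\<close> holds.\<close>

definition Phi :: "real \<Rightarrow> real \<Rightarrow> real" where
  "Phi k y = y * ln y - (1 / k) * (1 + k * y) * ln (1 + k * y) + y"

definition entropy :: "real \<Rightarrow> (real ^ 'n) set \<Rightarrow> (real ^ 'n \<Rightarrow> real ^ 'n \<Rightarrow> real) \<Rightarrow> real" where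
  "entropy k \<Omega> g = - phase_integral \<Omega> (\<lambda>x v. Phi k (g x v))"

definition energy :: "(real ^ 'n) set \<Rightarrow> (real ^ 'n \<Rightarrow> real ^ 'n \<Rightarrow> real) \<Rightarrow> real" where
  "energy \<Omega> g = phase_integral \<Omega> (\<lambda>x v. (norm v)\<^sup>2 / 2 * g x v)"

definition free_energy :: "real \<Rightarrow> (real ^ 'n) set \<Rightarrow> (real ^ 'n \<Rightarrow> real ^ 'n \<Rightarrow> real) \<Rightarrow> real" where
  "free_energy k \<Omega> g = phase_integral \<Omega> (\<lambda>x v. - ((norm v)\<^sup>2 / 2) * g x v - Phi k (g x v))"

text \<open>
  The functions over which the supremum of the free energy is taken. Those with a divergent
  free-energy integral are left out: for \<open>k < 1\<close> the positive part of the integrand is integrable,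
  so their free energy is \<open>-\<infinity>\<close>, whereas a divergent Bochner integral would count as \<open>0\<close>.
\<close>

definition admissible ::
    "real \<Rightarrow> (real ^ 'n) set \<Rightarrow> (real ^ 'n \<Rightarrow> real ^ 'n \<Rightarrow> real) \<Rightarrow> bool" where
  "admissible k \<Omega> g \<longleftrightarrow>
     set_borel_measurable lborel (\<Omega> \<times> UNIV) (\<lambda>(x, v). g x v) \<and>
     (\<forall>x\<in>\<Omega>. \<forall>v. 0 \<le> g x v \<and> 0 < 1 + k * g x v) \<and>
     (\<forall>x\<in>\<Omega>. integrable lborel (\<lambda>v. (norm v)\<^sup>2 / 2 * g x v)) \<and>
     phase_integrable \<Omega> (\<lambda>x v. - ((norm v)\<^sup>2 / 2) * g x v - Phi k (g x v))"

definition max_free_energy :: "real \<Rightarrow> (real ^ 'n) set \<Rightarrow> real" where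
  "max_free_energy k \<Omega> = Sup {free_energy k \<Omega> g | g. admissible k \<Omega> g}"

definition global_maxwellian :: "real \<Rightarrow> (real ^ 'n \<Rightarrow> real ^ 'n \<Rightarrow> real) \<Rightarrow> bool" where
  "global_maxwellian k M \<longleftrightarrow>
     (\<exists>C>0. 1 - k * C > 0 \<and>
        M = (\<lambda>x v. C * exp (- (norm v)\<^sup>2 / 2) / (1 - k * C * exp (- (norm v)\<^sup>2 / 2))))"

definition free_energy_gap ::
    "real \<Rightarrow> (real ^ 'n) set \<Rightarrow> (real ^ 'n \<Rightarrow> real ^ 'n \<Rightarrow> real) \<Rightarrow>
     (real ^ 'n \<Rightarrow> real ^ 'n \<Rightarrow> real) \<Rightarrow> real" where
  "free_energy_gap k \<Omega> M g = free_energy k \<Omega> M - free_energy k \<Omega> g"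

lemma phase_integrable_inner:
  assumes "phase_integrable \<Omega> g"
  shows "AE x in lborel. x \<in> \<Omega> \<longrightarrow> integrable lborel (g x)"
    and "set_integrable lborel \<Omega> (\<lambda>x. LINT v|lborel. g x v)"
proof -
  have int: "integrable (lborel \<Otimes>\<^sub>M lborel) (\<lambda>(x, v). indicat_real \<Omega> x *\<^sub>R g x v)"
    using assms unfolding phase_integrable_def set_integrable_def lborel_prod
    by (simp add: indicator_times case_prod_unfold)
  from lborel_pair.AE_integrable_fst'[OF int]
  show "AE x in lborel. x \<in> \<Omega> \<longrightarrow> integrable lborel (g x)"
    by (auto elim!: eventually_mono)
  from lborel_pair.integrable_fst'[OF int]
  show "set_integrable lborel \<Omega> (\<lambda>x. LINT v|lborel. g x v)"
    unfolding set_integrable_def by simp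
qed

lemma free_energy_eq_entropy_minus_energy:
  assumes S: "phase_integrable \<Omega> (\<lambda>x v. Phi k (g x v))"
    and E: "phase_integrable \<Omega> (\<lambda>x v. (norm v)\<^sup>2 / 2 * g x v)"
  shows "free_energy k \<Omega> g = entropy k \<Omega> g - energy \<Omega> g"
proof -
  let ?e = "\<lambda>x. LINT v|lborel. (norm v)\<^sup>2 / 2 * g x v"
  let ?s = "\<lambda>x. LINT v|lborel. Phi k (g x v)"
  let ?f = "\<lambda>x. LINT v|lborel. - ((norm v)\<^sup>2 / 2) * g x v - Phi k (g x v)"
  note S' = phase_integrable_inner[OF S] and E' = phase_integrable_inner[OF E]
  have "AE x in lborel. x \<in> \<Omega> \<longrightarrow> ?f x = - ?e x - ?s x"
    using S'(1) E'(1)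
  proof eventually_elim
    case (elim x)
    show ?case
    proof
      assume "x \<in> \<Omega>"
      with elim have "integrable lborel (\<lambda>v. - ((norm v)\<^sup>2 / 2 * g x v))"
        and "integrable lborel (\<lambda>v. Phi k (g x v))" by auto
      from Bochner_Integration.integral_diff[OF this] show "?f x = - ?e x - ?s x"
        by simp
    qed
  qed
  then have "AE x in lborel. indicat_real \<Omega> x *\<^sub>R ?f x =
      - (indicat_real \<Omega> x *\<^sub>R ?e x) - indicat_real \<Omega> x *\<^sub>R ?s x"
    by eventually_elim (auto simp: indicator_def)
  moreover have "integrable lborel (\<lambda>x. indicat_real \<Omega> x *\<^sub>R ?e x)"
    "integrable lborel (\<lambda>x. indicat_real \<Omega> x *\<^sub>R ?s x)"
    using S'(2) E'(2) unfolding set_integrable_def by auto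
  moreover have "phase_integrable \<Omega> (\<lambda>x v. - ((norm v)\<^sup>2 / 2) * g x v - Phi k (g x v))"
    using Bochner_Integration.integrable_diff[OF integrable_minus[OF
        E[unfolded phase_integrable_def set_integrable_def]]
        S[unfolded phase_integrable_def set_integrable_def]]
    unfolding phase_integrable_def set_integrable_def
    by (simp add: case_prod_unfold algebra_simps)
  then have "integrable lborel (\<lambda>x. indicat_real \<Omega> x *\<^sub>R ?f x)"
    using phase_integrable_inner(2) unfolding set_integrable_def by blast
  ultimately have "(LINT x|lborel. indicat_real \<Omega> x *\<^sub>R ?f x) =
      - (LINT x|lborel. indicat_real \<Omega> x *\<^sub>R ?e x) - (LINT x|lborel. indicat_real \<Omega> x *\<^sub>R ?s x)"
    by (subst integral_cong_AE) (auto intro!: borel_measurable_integrable)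
  then show ?thesis
    unfolding free_energy_def entropy_def energy_def phase_integral_def set_lebesgue_integral_def
    by simp
qed


section \<open>Energy flux and entropy flow\<close>

definition energy_flux :: "(real ^ 'n) set \<Rightarrow> (real ^ 'n \<Rightarrow> real ^ 'n \<Rightarrow> real) \<Rightarrow> real" where
  "energy_flux \<Omega> g =
     phase_integral \<Omega> (\<lambda>x v. (norm v)\<^sup>2 / 2 * (v \<bullet> grad (\<lambda>y. g y v) x))"

definition entropy_flow :: "real \<Rightarrow> (real ^ 'n) set \<Rightarrow> (real ^ 'n \<Rightarrow> real ^ 'n \<Rightarrow> real) \<Rightarrow> real" where
  "entropy_flow k \<Omega> g =
     - phase_integral \<Omega> (\<lambda>x v. (ln (g x v / (1 + k * g x v)) + 1) * (v \<bullet> grad (\<lambda>y. g y v) x))"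


section \<open>Solutions of the Fokker-Planck equation\<close>

definition class_C01 :: "(real ^ 'n) set \<Rightarrow> (real ^ 'n \<Rightarrow> real ^ 'n \<Rightarrow> real) \<Rightarrow> bool" where
  "class_C01 \<Omega> g \<longleftrightarrow>
     (\<lambda>(x, v). g x v) differentiable_on (\<Omega> \<times> UNIV) \<and>
     (\<forall>x\<in>\<Omega>. (g x \<longlongrightarrow> 0) at_infinity)"

text \<open>One-sided at an endpoint of the time interval \<open>T\<close>.\<close>

definition time_deriv ::
    "real set \<Rightarrow> (real \<Rightarrow> real ^ 'n \<Rightarrow> real ^ 'n \<Rightarrow> real) \<Rightarrow> real \<Rightarrow> real ^ 'n \<Rightarrow> real ^ 'n \<Rightarrow> real" where
  "time_deriv T f t x v = vector_derivative (\<lambda>s. f s x v) (at t within T)"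

definition fokker_planck_solution ::
    "real \<Rightarrow> (real ^ 'n) set \<Rightarrow> real set \<Rightarrow> (real \<Rightarrow> real ^ 'n \<Rightarrow> real ^ 'n \<Rightarrow> real) \<Rightarrow> bool" where
  "fokker_planck_solution k \<Omega> T f \<longleftrightarrow>
     is_interval T \<and> interior T \<noteq> {} \<and>
     (\<forall>t\<in>T. class_C01 \<Omega> (f t)) \<and>
     (\<forall>t\<in>T. \<forall>x\<in>\<Omega>. \<forall>v.
        (\<lambda>s. f s x v) differentiable (at t within T) \<and>
        (\<forall>i. (\<lambda>s. partial_deriv i (f t x) (v + s *\<^sub>R axis i 1)) differentiable (at 0)) \<and>
        time_deriv T f t x v =
          laplacian (f t x) v - v \<bullet> grad (\<lambda>y. f t y v) x
          + divergence (\<lambda>w. (f t x w * (1 + k * f t x w)) *\<^sub>R w) v)"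

text \<open>
  Up to the transport term, the right-hand side of the equation is the divergence in \<open>v\<close> of
  \<open>velocity_current\<close>.
\<close>

definition velocity_current :: "real \<Rightarrow> (real ^ 'n \<Rightarrow> real) \<Rightarrow> real ^ 'n \<Rightarrow> real ^ 'n" where
  "velocity_current k u v = grad u v + (u v * (1 + k * u v)) *\<^sub>R v"

definition multiplier :: "real \<Rightarrow> (real ^ 'n \<Rightarrow> real) \<Rightarrow> real ^ 'n \<Rightarrow> real" where
  "multiplier k u v = ln (u v / (1 + k * u v)) + 1 + (norm v)\<^sup>2 / 2"

definition integrals_converge ::
    "real \<Rightarrow> (real ^ 'n) set \<Rightarrow> (real ^ 'n \<Rightarrow> real ^ 'n \<Rightarrow> real) \<Rightarrow> bool" where
  "integrals_converge k \<Omega> g \<longleftrightarrow>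
     phase_integrable \<Omega> (\<lambda>x v. Phi k (g x v)) \<and>
     phase_integrable \<Omega> (\<lambda>x v. (norm v)\<^sup>2 / 2 * g x v) \<and>
     phase_integrable \<Omega> (\<lambda>x v. (norm v)\<^sup>2 / 2 * (v \<bullet> grad (\<lambda>y. g y v) x)) \<and>
     phase_integrable \<Omega>
       (\<lambda>x v. (ln (g x v / (1 + k * g x v)) + 1) * (v \<bullet> grad (\<lambda>y. g y v) x))"

definition differentiable_under_integral ::
    "real \<Rightarrow> (real ^ 'n) set \<Rightarrow> real set \<Rightarrow> (real \<Rightarrow> real ^ 'n \<Rightarrow> real ^ 'n \<Rightarrow> real) \<Rightarrow> bool" where
  "differentiable_under_integral k \<Omega> T f \<longleftrightarrow>
     (\<forall>t\<in>T.
        phase_integrable \<Omega> (\<lambda>x v. (norm v)\<^sup>2 / 2 * time_deriv T f t x v) \<and>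
        phase_integrable \<Omega> (time_deriv T (\<lambda>s x v. Phi k (f s x v)) t) \<and>
        ((\<lambda>s. energy \<Omega> (f s)) has_real_derivative
           phase_integral \<Omega> (\<lambda>x v. (norm v)\<^sup>2 / 2 * time_deriv T f t x v)) (at t within T) \<and>
        ((\<lambda>s. entropy k \<Omega> (f s)) has_real_derivative
           - phase_integral \<Omega> (time_deriv T (\<lambda>s x v. Phi k (f s x v)) t)) (at t within T))"

text \<open>
  Multiplying the equation by \<open>multiplier\<close>, integrating, and integrating by parts in \<open>v\<^sub>i\<close> the
  \<open>i\<close>-th summand of the divergence of the current leaves, as terms at infinity, the values of
  multiplier times current at \<open>v\<^sub>i = \<plusminus>\<infinity>\<close>. These vanish, and the integral of each summand converges.
\<close>

definition no_terms_at_infinity ::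
    "real \<Rightarrow> (real ^ 'n) set \<Rightarrow> (real ^ 'n \<Rightarrow> real ^ 'n \<Rightarrow> real) \<Rightarrow> bool" where
  "no_terms_at_infinity k \<Omega> g \<longleftrightarrow>
     (\<forall>i.
        phase_integrable \<Omega>
          (\<lambda>x v. multiplier k (g x) v * partial_deriv i (\<lambda>w. velocity_current k (g x) w $ i) v) \<and>
        (\<forall>x\<in>\<Omega>. \<forall>v.
           let b = (\<lambda>s. multiplier k (g x) (v + s *\<^sub>R axis i 1) *
                        velocity_current k (g x) (v + s *\<^sub>R axis i 1) $ i)
           in (b \<longlongrightarrow> 0) at_top \<and> (b \<longlongrightarrow> 0) at_bot))"

text \<open>Each solution comes with its own time interval.\<close>

definition dissipative_class ::
    "real \<Rightarrow> (real ^ 'n) set \<Rightarrow> (real set \<times> (real \<Rightarrow> real ^ 'n \<Rightarrow> real ^ 'n \<Rightarrow> real)) set" where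
  "dissipative_class k \<Omega> =
     {(T, f). fokker_planck_solution k \<Omega> T f \<and>
        (\<forall>t\<in>T. \<forall>x\<in>\<Omega>. \<forall>v. 0 < f t x v \<and> 0 < 1 + k * f t x v) \<and>
        (\<forall>t\<in>T. integrals_converge k \<Omega> (f t)) \<and>
        differentiable_under_integral k \<Omega> T f \<and>
        (\<forall>t\<in>T. no_terms_at_infinity k \<Omega> (f t)) \<and>
        (\<forall>t\<in>T. 0 \<le> energy_flux \<Omega> (f t)) \<and>
        (\<forall>t\<in>T. entropy_flow k \<Omega> (f t) \<le> 0)}"

definition lyapunov_stable ::
    "((real ^ 'n \<Rightarrow> real ^ 'n \<Rightarrow> real) \<Rightarrow> real) \<Rightarrow>
     (real set \<times> (real \<Rightarrow> real ^ 'n \<Rightarrow> real ^ 'n \<Rightarrow> real)) set \<Rightarrow> bool" where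
  "lyapunov_stable G \<F> \<longleftrightarrow>
     (\<forall>\<epsilon>>0. \<exists>\<delta>>0. \<forall>(T, f)\<in>\<F>. \<forall>t\<^sub>0\<in>T.
        G (f t\<^sub>0) < \<delta> \<longrightarrow> (\<forall>t\<in>T. t > t\<^sub>0 \<longrightarrow> G (f t) < \<epsilon>))"

end

theory Submission
  imports Defs
begin

text \<open>
  The free energy does not decrease along a dissipative solution with nonpositive entropy flow, so
  the gap does not increase, and \<open>\<delta> = \<epsilon>\<close> serves in the definition of stability.

  Write \<open>m = ln (f / (1 + k f)) + 1 + |v|\<^sup>2 / 2\<close> for the multiplier and
  \<open>J = grad\<^sub>v f + f (1 + k f) v\<close> for the velocity current. Since \<open>Phi' = ln (y / (1 + k y)) + 1\<close>,
  the derivative of the free energy in time is minus the integral of \<open>m \<partial>\<^sub>t f\<close>. The equation reads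
  \<open>\<partial>\<^sub>t f = div\<^sub>v J - v \<bullet> grad\<^sub>x f\<close>, and the transport term contributes the energy flux
  minus the entropy flow, which is nonnegative. It remains to see
  that the integral of \<open>m \<partial>\<^sub>i J\<^sub>i\<close> is nonpositive for each \<open>i\<close>. The point is that
  \<open>\<partial>\<^sub>i m = J\<^sub>i / (f (1 + k f))\<close>, whence
  \<open>m \<partial>\<^sub>i J\<^sub>i = \<partial>\<^sub>i (m J\<^sub>i) - J\<^sub>i\<^sup>2 / (f (1 + k f)) \<le> \<partial>\<^sub>i (m J\<^sub>i)\<close>
  (\<open>multiplier_times_current_derivative\<close>). As \<open>m J\<^sub>i\<close> vanishes at both ends of every line
  parallel to the \<open>i\<close>-th axis, the integral over each such line is nonpositive
  (\<open>line_integral_nonpos\<close>), and so is the integral over all velocities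
  (\<open>integral_nonpos_if_line_integrals_nonpos\<close>). Only an inequality is used, so the integrability of
  \<open>J\<^sub>i\<^sup>2 / (f (1 + k f))\<close> plays no role.
\<close>

section \<open>Integration along the lines parallel to an axis\<close>

lemma integral_nonpos:
  fixes g :: "'a \<Rightarrow> real"
  assumes "\<And>x. g x \<le> 0"
  shows "(LINT x|M. g x) \<le> 0"
  using Bochner_Integration.integral_nonneg[of M "\<lambda>x. - g x"] assms by simp

text \<open>
  A function bounded above by a derivative whose primitive vanishes at both ends. If it is not
  integrable, its Bochner integral is \<open>0\<close> by convention, and the bound persists.
\<close>

lemma line_integral_nonpos:
  fixes g b b' :: "real \<Rightarrow> real"
  assumes der: "\<And>s. (b has_real_derivative b' s) (at s)"
    and le: "\<And>s. g s \<le> b' s"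
    and top: "(b \<longlongrightarrow> 0) at_top" and bot: "(b \<longlongrightarrow> 0) at_bot"
  shows "(LINT s|lborel. g s) \<le> 0"
proof (cases "integrable lborel g")
  case False
  then show ?thesis by (simp add: not_integrable_integral_eq)
next
  case True
  let ?I = "\<lambda>n::nat. LINT s:{- real n..real n}|lborel. g s"
  have up: "?I n \<le> b (real n) - b (- real n)" for n
  proof -
    have si: "set_integrable lborel {- real n..real n} g"
      unfolding set_integrable_def using True
      by (intro integrable_mult_indicator) auto
    have "(g has_integral ?I n) {- real n..real n}"
      using set_borel_integral_eq_integral[OF si] by (simp add: has_integral_iff)
    moreover have "(b' has_integral (b (real n) - b (- real n))) {- real n..real n}"
      by (rule fundamental_theorem_of_calculus)
        (auto intro!: has_field_derivative_at_within der
          simp: has_real_derivative_iff_has_vector_derivative[symmetric])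
    ultimately show ?thesis
      by (rule has_integral_le) (use le in auto)
  qed
  have lim: "?I \<longlonglongrightarrow> (LINT s|lborel. g s)"
    unfolding set_lebesgue_integral_def
  proof (rule integral_dominated_convergence[where w = "\<lambda>s. \<bar>g s\<bar>"])
    show "AE s in lborel. (\<lambda>n. indicat_real {- real n..real n} s *\<^sub>R g s) \<longlonglongrightarrow> g s"
    proof (intro AE_I2 tendsto_eventually)
      fix s :: real
      obtain N :: nat where "\<bar>s\<bar> \<le> real N" using real_arch_simple by blast
      then show "\<forall>\<^sub>F n in sequentially. indicat_real {- real n..real n} s *\<^sub>R g s = g s"
        by (intro eventually_sequentiallyI[of N]) (auto simp: indicator_def abs_le_iff)
    qed
  qed (use True in \<open>auto simp: indicator_def\<close>)
  have "(\<lambda>n. b (real n) - b (- real n)) \<longlonglongrightarrow> 0 - 0"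
    by (intro tendsto_diff filterlim_compose[OF top] filterlim_compose[OF bot]
        filterlim_real_sequentially
        filterlim_compose[OF filterlim_uminus_at_bot_at_top filterlim_real_sequentially])
  with LIMSEQ_le[OF lim, of "\<lambda>n. b (real n) - b (- real n)" "0 - 0"] up show ?thesis
    by auto
qed

text \<open>
  Fubini's theorem in the direction of one axis. Instead of splitting the space as a product, the
  integrals over the lines are averaged over the slab of points whose \<open>i\<close>-th coordinate lies in
  the unit interval: each line parallel to the axis meets it in a segment of length one.
\<close>

lemma integral_nonpos_if_line_integrals_nonpos:
  fixes g :: "real ^ 'n \<Rightarrow> real"
  assumes line: "\<And>v. (LINT s|lborel. g (v + s *\<^sub>R axis i 1)) \<le> 0"
  shows "(LINT v|lborel. g v) \<le> 0"
proof (cases "integrable lborel g")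
  case False
  then show ?thesis by (simp add: not_integrable_integral_eq)
next
  case True
  let ?e = "axis i 1 :: real ^ 'n"
  define S where "S = {v :: real ^ 'n. v $ i \<in> {0..1}}"
  let ?h = "\<lambda>s v. indicat_real S v * g (v + s *\<^sub>R ?e)"
  let ?k = "\<lambda>s v. indicat_real S (v - s *\<^sub>R ?e) * g v"
  have [measurable]: "g \<in> borel_measurable borel"
    using True by auto
  have [measurable]: "S \<in> sets borel"
    unfolding S_def by measurable
  have seg: "indicat_real S (v - s *\<^sub>R ?e) = indicat_real {v $ i - 1..v $ i} s"
    for v :: "real ^ 'n" and s
    by (auto simp: indicator_def S_def)
  have shift: "has_bochner_integral lborel (\<lambda>v. F (v + c)) (LINT v|lborel. F v)"
    if "integrable lborel F" for F :: "real ^ 'n \<Rightarrow> real" and c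
  proof -
    have "integrable (distr lborel borel ((+) c)) F"
      using that by (simp add: lborel_distr_plus)
    then have "integrable lborel (\<lambda>v. F (c + v))"
      by (subst (asm) integrable_distr_eq) (use that in auto)
    moreover have "(LINT v|distr lborel borel ((+) c). F v) = (LINT v|lborel. F (c + v))"
      by (subst integral_distr) (use that in auto)
    ultimately show ?thesis
      by (simp add: has_bochner_integral_iff lborel_distr_plus add.commute)
  qed
  have [simp]: "?k s (v + s *\<^sub>R ?e) = ?h s v" for s v
    by simp
  have int_k: "integrable (lborel \<Otimes>\<^sub>M lborel) (\<lambda>(v, s). ?k s v)"
  proof (rule lborel_pair.Fubini_integrable)
    show "(\<lambda>(v, s). ?k s v) \<in> borel_measurable (lborel \<Otimes>\<^sub>M lborel)"
      by measurable
    show "integrable lborel (\<lambda>v. LINT s|lborel. norm (case (v, s) of (v, s) \<Rightarrow> ?k s v))"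
      using True by (simp add: seg abs_mult)
    show "AE v in lborel. integrable lborel (\<lambda>s. case (v, s) of (v, s) \<Rightarrow> ?k s v)"
      by (simp add: seg)
  qed
  have int_k': "integrable lborel (?k s)" for s
    using True by (intro Bochner_Integration.integrable_bound[OF True]) (auto simp: indicator_def)
  have hk: "has_bochner_integral lborel (?h s) (LINT v|lborel. ?k s v)" for s
    using shift[OF int_k'[of s], of "s *\<^sub>R ?e"] by simp
  have hk_abs: "has_bochner_integral lborel (\<lambda>v. \<bar>?h s v\<bar>) (LINT v|lborel. \<bar>?k s v\<bar>)" for s
    using shift[OF integrable_abs[OF int_k'[of s]], of "s *\<^sub>R ?e"] by simp
  have int_h: "integrable (lborel \<Otimes>\<^sub>M lborel) (\<lambda>(s, v). ?h s v)"
  proof (rule lborel_pair.Fubini_integrable)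
    show "(\<lambda>(s, v). ?h s v) \<in> borel_measurable (lborel \<Otimes>\<^sub>M lborel)"
      by measurable
    have "integrable lborel (\<lambda>s. LINT v|lborel. \<bar>?k s v\<bar>)"
      using lborel_pair.integrable_snd[of "\<lambda>v s. \<bar>?k s v\<bar>"] integrable_abs[OF int_k]
      by (simp add: case_prod_unfold)
    then show "integrable lborel (\<lambda>s. LINT v|lborel. norm (case (s, v) of (s, v) \<Rightarrow> ?h s v))"
      using hk_abs by (simp add: has_bochner_integral_iff)
    show "AE s in lborel. integrable lborel (\<lambda>v. case (s, v) of (s, v) \<Rightarrow> ?h s v)"
      using hk by (simp add: has_bochner_integral_iff)
  qed
  \<comment> \<open>The factor of \<open>g v\<close> in \<open>?k s v\<close> integrates to one in \<open>s\<close>; \<open>?h s\<close> is a translate of \<open>?k s\<close>.\<close>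
  have "(LINT v|lborel. g v) = (LINT v|lborel. LINT s|lborel. ?k s v)"
    by (simp add: seg)
  also have "\<dots> = (LINT s|lborel. LINT v|lborel. ?k s v)"
    using lborel_pair.Fubini_integral[of "\<lambda>v s. ?k s v"] int_k by simp
  also have "\<dots> = (LINT s|lborel. LINT v|lborel. ?h s v)"
    using hk by (simp add: has_bochner_integral_iff)
  also have "\<dots> = (LINT v|lborel. LINT s|lborel. ?h s v)"
    using lborel_pair.Fubini_integral[of "\<lambda>s v. ?h s v"] int_h by simp
  also have "\<dots> \<le> 0"
    by (rule integral_nonpos) (simp add: line mult_le_0_iff)
  finally show ?thesis .
qed


section \<open>Linearity of the integral over phase space\<close>

text \<open>
  For integrable functions the iterated integral is an integral over the product, and additivity
  is inherited from there.
\<close>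

lemma phase_integral_eq:
  assumes "phase_integrable \<Omega> g"
  shows "phase_integral \<Omega> g = (LINT z:\<Omega> \<times> UNIV|lborel. g (fst z) (snd z))"
proof -
  have int: "integrable (lborel \<Otimes>\<^sub>M lborel) (\<lambda>(x, v). indicat_real \<Omega> x *\<^sub>R g x v)"
    using assms unfolding phase_integrable_def set_integrable_def lborel_prod
    by (simp add: indicator_times case_prod_unfold)
  from lborel_pair.integral_fst'[OF int] show ?thesis
    unfolding phase_integral_def set_lebesgue_integral_def lborel_prod
    by (simp add: indicator_times case_prod_unfold)
qed

lemma phase_integrable_add:
  "phase_integrable \<Omega> g \<Longrightarrow> phase_integrable \<Omega> h \<Longrightarrow> phase_integrable \<Omega> (\<lambda>x v. g x v + h x v)"
  unfolding phase_integrable_def by (simp add: case_prod_unfold set_integral_add)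

lemma phase_integral_add:
  "phase_integrable \<Omega> g \<Longrightarrow> phase_integrable \<Omega> h \<Longrightarrow>
    phase_integral \<Omega> (\<lambda>x v. g x v + h x v) = phase_integral \<Omega> g + phase_integral \<Omega> h"
  using phase_integrable_add[of \<Omega> g h]
  by (simp add: phase_integral_eq)
     (simp add: phase_integrable_def case_prod_unfold set_integral_add)

lemma phase_integral_sum:
  assumes "finite I" and "\<And>i. i \<in> I \<Longrightarrow> phase_integrable \<Omega> (g i)"
  shows "phase_integrable \<Omega> (\<lambda>x v. \<Sum>i\<in>I. g i x v) \<and>
    phase_integral \<Omega> (\<lambda>x v. \<Sum>i\<in>I. g i x v) = (\<Sum>i\<in>I. phase_integral \<Omega> (g i))"
  using assms
proof (induction I rule: finite_induct)
  case empty
  then show ?case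
    by (simp add: phase_integrable_def phase_integral_def set_integrable_def
        set_lebesgue_integral_def case_prod_unfold)
next
  case (insert i I)
  then show ?case
    by (simp add: phase_integrable_add phase_integral_add)
qed

lemma phase_integral_cong:
  "(\<And>x v. x \<in> \<Omega> \<Longrightarrow> g x v = h x v) \<Longrightarrow> phase_integral \<Omega> g = phase_integral \<Omega> h"
  unfolding phase_integral_def set_lebesgue_integral_def
  by (intro Bochner_Integration.integral_cong)
    (auto simp: indicator_def intro!: Bochner_Integration.integral_cong)

lemma phase_integral_nonpos:
  "(\<And>x. x \<in> \<Omega> \<Longrightarrow> (LINT v|lborel. g x v) \<le> 0) \<Longrightarrow> phase_integral \<Omega> g \<le> 0"
  unfolding phase_integral_def set_lebesgue_integral_def
  by (intro integral_nonpos) (auto simp: indicator_def)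


section \<open>The velocity current along an axis\<close>

lemma partial_deriv_has_derivative:
  assumes "(\<lambda>s. u (v + s *\<^sub>R axis i 1)) differentiable (at 0)"
  shows "((\<lambda>s. u (v + s *\<^sub>R axis i 1)) has_real_derivative partial_deriv i u v) (at 0)"
  using assms by (simp add: partial_deriv_def DERIV_deriv_iff_real_differentiable)

lemma differentiable_along_axis:
  fixes u :: "real ^ 'n \<Rightarrow> real"
  assumes "u differentiable (at v)"
  shows "(\<lambda>s. u (v + s *\<^sub>R axis i 1)) differentiable (at 0)"
proof -
  have "(\<lambda>s :: real. v + s *\<^sub>R axis i 1) differentiable (at 0)"
    by (intro derivative_intros)
  with differentiable_chain_at[of "\<lambda>s. v + s *\<^sub>R axis i 1" 0 u] assms show ?thesis
    by (simp add: o_def)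
qed

lemma drift_along_axis_differentiable:
  fixes u :: "real ^ 'n \<Rightarrow> real"
  assumes "u differentiable (at v)"
  shows "(\<lambda>s. u (v + s *\<^sub>R axis i 1) * (1 + k * u (v + s *\<^sub>R axis i 1)) * (v + s *\<^sub>R axis i 1) $ i)
      differentiable (at 0)"
  by (intro derivative_intros differentiable_along_axis assms
      bounded_linear_imp_differentiable[OF bounded_linear_vec_nth])

lemma current_along_axis_differentiable:
  fixes u :: "real ^ 'n \<Rightarrow> real"
  assumes "u differentiable (at v)"
    and "(\<lambda>s. partial_deriv i u (v + s *\<^sub>R axis i 1)) differentiable (at 0)"
  shows "(\<lambda>s. velocity_current k u (v + s *\<^sub>R axis i 1) $ i) differentiable (at 0)"
  unfolding velocity_current_def grad_def
  using drift_along_axis_differentiable[OF assms(1), of i k] assms(2) by simp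

lemma divergence_velocity_current:
  fixes u :: "real ^ 'n \<Rightarrow> real"
  assumes "u differentiable (at v)"
    and "\<And>i. (\<lambda>s. partial_deriv i u (v + s *\<^sub>R axis i 1)) differentiable (at 0)"
  shows "divergence (velocity_current k u) v =
    laplacian u v + divergence (\<lambda>w. (u w * (1 + k * u w)) *\<^sub>R w) v"
  unfolding laplacian_def divergence_def sum.distrib[symmetric]
proof (rule sum.cong[OF refl])
  fix i
  show "partial_deriv i (\<lambda>q. velocity_current k u q $ i) v =
    partial_deriv i (\<lambda>q. grad u q $ i) v +
    partial_deriv i (\<lambda>q. ((u q * (1 + k * u q)) *\<^sub>R q) $ i) v"
    using DERIV_add[OF partial_deriv_has_derivative[OF assms(2)]
        partial_deriv_has_derivative[where u = "\<lambda>q. u q * (1 + k * u q) * q $ i",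
          OF drift_along_axis_differentiable[OF assms(1)]]]
    by (simp add: velocity_current_def grad_def partial_deriv_def DERIV_imp_deriv)
qed

text \<open>
  The multiplier is chosen so that its gradient is the current divided by \<open>u (1 + k u)\<close>; the product
  rule therefore produces the square of the current, and the last summand below is nonnegative.
\<close>

lemma multiplier_times_current_derivative:
  fixes u :: "real ^ 'n \<Rightarrow> real"
  assumes pos: "0 < u v" "0 < 1 + k * u v"
    and "u differentiable (at v)"
    and "(\<lambda>s. partial_deriv i u (v + s *\<^sub>R axis i 1)) differentiable (at 0)"
  shows "((\<lambda>s. multiplier k u (v + s *\<^sub>R axis i 1) * velocity_current k u (v + s *\<^sub>R axis i 1) $ i)
      has_real_derivative
      multiplier k u v * partial_deriv i (\<lambda>w. velocity_current k u w $ i) v +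
      (velocity_current k u v $ i)\<^sup>2 / (u v * (1 + k * u v))) (at 0)"
proof -
  let ?e = "axis i 1 :: real ^ 'n"
  note dJ = partial_deriv_has_derivative[where u = "\<lambda>w. velocity_current k u w $ i",
      OF current_along_axis_differentiable[OF assms(3,4), of k]]
  note du = partial_deriv_has_derivative[OF differentiable_along_axis[OF assms(3), of i]]
  have norm_sq: "(norm (v + s *\<^sub>R ?e))\<^sup>2 = (norm v)\<^sup>2 + 2 * s * v $ i + s\<^sup>2" for s
    unfolding power2_norm_eq_inner
    by (simp add: inner_add_left inner_add_right inner_axis inner_axis'
        power2_eq_square algebra_simps)
  have du_div: "((\<lambda>s. u (v + s *\<^sub>R ?e) / (1 + k * u (v + s *\<^sub>R ?e))) has_real_derivative
      partial_deriv i u v / (1 + k * u v)\<^sup>2) (at 0)"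
    by (rule derivative_eq_intros du refl | use pos in \<open>simp; fail\<close>)+
      (use pos in \<open>simp add: power2_eq_square algebra_simps\<close>)
  have "((\<lambda>s. multiplier k u (v + s *\<^sub>R ?e)) has_real_derivative
      (1 + k * u v) / u v * (partial_deriv i u v / (1 + k * u v)\<^sup>2) + v $ i) (at 0)"
    unfolding multiplier_def norm_sq
    by (rule derivative_eq_intros du_div refl | use pos in \<open>simp; fail\<close>)+
  moreover have "(1 + k * u v) / u v * (partial_deriv i u v / (1 + k * u v)\<^sup>2) + v $ i =
      velocity_current k u v $ i / (u v * (1 + k * u v))"
  proof -
    have "p / y * (q / p\<^sup>2) + z = (q + y * p * z) / (y * p)" if "0 < y" "0 < p" for p q y z :: real
      using that by (simp add: field_simps power2_eq_square)
    from this[OF pos] show ?thesis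
      by (simp add: velocity_current_def grad_def)
  qed
  ultimately have "((\<lambda>s. multiplier k u (v + s *\<^sub>R ?e)) has_real_derivative
      velocity_current k u v $ i / (u v * (1 + k * u v))) (at 0)"
    by simp
  from DERIV_mult[OF this dJ] show ?thesis
    by (simp add: power2_eq_square algebra_simps)
qed

lemma integral_multiplier_divergence_current_nonpos:
  fixes u :: "real ^ 'n \<Rightarrow> real"
  assumes pos: "\<And>v. 0 < u v" "\<And>v. 0 < 1 + k * u v"
    and diff: "\<And>v. u differentiable (at v)"
      "\<And>v. (\<lambda>s. partial_deriv i u (v + s *\<^sub>R axis i 1)) differentiable (at 0)"
    and lim: "\<And>v F. F \<in> {at_top, at_bot} \<Longrightarrow>
      ((\<lambda>s. multiplier k u (v + s *\<^sub>R axis i 1) * velocity_current k u (v + s *\<^sub>R axis i 1) $ i)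
        \<longlongrightarrow> 0) F"
  shows "(LINT v|lborel. multiplier k u v * partial_deriv i (\<lambda>w. velocity_current k u w $ i) v) \<le> 0"
    (is "(LINT v|lborel. ?g v) \<le> 0")
proof (rule integral_nonpos_if_line_integrals_nonpos[where i = i])
  fix v :: "real ^ 'n"
  let ?e = "axis i 1 :: real ^ 'n"
  let ?b = "\<lambda>w. multiplier k u w * velocity_current k u w $ i"
  let ?r = "\<lambda>w. (velocity_current k u w $ i)\<^sup>2 / (u w * (1 + k * u w))"
  show "(LINT s|lborel. ?g (v + s *\<^sub>R ?e)) \<le> 0"
  proof (rule line_integral_nonpos[where b = "\<lambda>s. ?b (v + s *\<^sub>R ?e)"
        and b' = "\<lambda>s. ?g (v + s *\<^sub>R ?e) + ?r (v + s *\<^sub>R ?e)"])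
    fix s :: real
    have "((\<lambda>r. ?b (v + s *\<^sub>R ?e + r *\<^sub>R ?e)) has_real_derivative
        ?g (v + s *\<^sub>R ?e) + ?r (v + s *\<^sub>R ?e)) (at 0)"
      by (intro multiplier_times_current_derivative pos diff)
    moreover have "v + s *\<^sub>R ?e + r *\<^sub>R ?e = v + (r + s) *\<^sub>R ?e" for r
      by (simp add: scaleR_add_left)
    ultimately show "((\<lambda>s. ?b (v + s *\<^sub>R ?e)) has_real_derivative
        ?g (v + s *\<^sub>R ?e) + ?r (v + s *\<^sub>R ?e)) (at s)"
      using DERIV_shift[of "\<lambda>s. ?b (v + s *\<^sub>R ?e)" _ 0 s, THEN iffD2] by (simp only: add_0)
    show "?g (v + s *\<^sub>R ?e) \<le> ?g (v + s *\<^sub>R ?e) + ?r (v + s *\<^sub>R ?e)"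
      using pos by (simp add: less_imp_le)
  qed (use lim in auto)
qed


section \<open>Growth of the free energy along solutions\<close>

lemma Phi_has_real_derivative:
  assumes "k \<noteq> 0" "0 < y" "0 < 1 + k * y"
  shows "(Phi k has_real_derivative ln (y / (1 + k * y)) + 1) (at y)"
proof -
  let ?p = "1 + k * y"
  have "((\<lambda>y. y * ln y) has_real_derivative ln y + 1) (at y)"
    by (rule derivative_eq_intros refl | use assms in \<open>simp; fail\<close>)+
  moreover have "((\<lambda>y. (1 / k) * ((1 + k * y) * ln (1 + k * y))) has_real_derivative ln ?p + 1) (at y)"
  proof -
    have "((\<lambda>y. 1 + k * y) has_real_derivative k) (at y)"
      by (auto intro!: derivative_eq_intros)
    from DERIV_cmult[OF DERIV_mult[OF this DERIV_ln_divide[THEN DERIV_chain2, OF assms(3) this]], of "1 / k"]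
    show ?thesis
      by (rule DERIV_cong) (use assms in simp, simp add: field_simps)
  qed
  ultimately have "((\<lambda>y. y * ln y - (1 / k) * ((1 + k * y) * ln (1 + k * y)) + y)
      has_real_derivative ln y + 1 - (ln ?p + 1) + 1) (at y)"
    by (intro DERIV_add DERIV_diff DERIV_ident)
  then show ?thesis
    using assms unfolding Phi_def by (simp add: ln_div mult.assoc)
qed

lemma time_deriv_Phi:
  assumes "is_interval T" "interior T \<noteq> {}" "t \<in> T" "k \<noteq> 0"
    and pos: "0 < f t x v" "0 < 1 + k * f t x v"
    and diff: "(\<lambda>s. f s x v) differentiable (at t within T)"
  shows "time_deriv T (\<lambda>s x v. Phi k (f s x v)) t x v =
    (ln (f t x v / (1 + k * f t x v)) + 1) * time_deriv T f t x v"
proof -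
  \<comment> \<open>Derivatives within \<open>T\<close> are unique because \<open>T\<close> is a nondegenerate interval.\<close>
  have nontriv: "at t within T \<noteq> bot"
  proof -
    have "T \<noteq> {t}"
      using assms(2) by auto
    with assms(1,3) have "t islimpt T"
      by (intro connected_imp_perfect) (auto simp: is_interval_connected)
    then show ?thesis by (simp add: trivial_limit_within)
  qed
  have "((\<lambda>s. f s x v) has_real_derivative time_deriv T f t x v) (at t within T)"
    using vector_derivative_works[THEN iffD1, OF diff]
    by (simp add: time_deriv_def has_real_derivative_iff_has_vector_derivative)
  from DERIV_chain2[OF Phi_has_real_derivative[OF \<open>k \<noteq> 0\<close> pos] this] show ?thesis
    unfolding time_deriv_def has_real_derivative_iff_has_vector_derivative
    by (intro vector_derivative_within nontriv) 
qed

text \<open>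
  The left-hand side is minus the rate of change of the free energy. The estimate results from
  integrating the equation times the multiplier over phase space.
\<close>

lemma free_energy_dissipation:
  assumes "open \<Omega>" "k \<noteq> 0" "(T, f) \<in> dissipative_class k \<Omega>" "t \<in> T"
  shows "phase_integral \<Omega> (\<lambda>x v. (norm v)\<^sup>2 / 2 * time_deriv T f t x v) +
    phase_integral \<Omega> (time_deriv T (\<lambda>s x v. Phi k (f s x v)) t) \<le> 0"
proof -
  have sol: "fokker_planck_solution k \<Omega> T f"
    and pos: "\<And>x v. x \<in> \<Omega> \<Longrightarrow> 0 < f t x v" "\<And>x v. x \<in> \<Omega> \<Longrightarrow> 0 < 1 + k * f t x v"
    and conv: "integrals_converge k \<Omega> (f t)"
    and dui: "differentiable_under_integral k \<Omega> T f"
    and inf: "no_terms_at_infinity k \<Omega> (f t)"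
    and flux: "0 \<le> energy_flux \<Omega> (f t)" "entropy_flow k \<Omega> (f t) \<le> 0"
    using assms(3,4) by (auto simp: dissipative_class_def)
  define a where "a = (\<lambda>x v. (norm v)\<^sup>2 / 2 * time_deriv T f t x v)"
  define b where "b = time_deriv T (\<lambda>s x v. Phi k (f s x v)) t"
  define c where "c = (\<lambda>i x v. multiplier k (f t x) v *
    partial_deriv i (\<lambda>w. velocity_current k (f t x) w $ i) v)"
  define d where "d = (\<lambda>x v. (norm v)\<^sup>2 / 2 * (v \<bullet> grad (\<lambda>y. f t y v) x))"
  define e where "e = (\<lambda>x v. (ln (f t x v / (1 + k * f t x v)) + 1) * (v \<bullet> grad (\<lambda>y. f t y v) x))"
  have int: "phase_integrable \<Omega> a" "phase_integrable \<Omega> b" "\<And>i. phase_integrable \<Omega> (c i)"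
    "phase_integrable \<Omega> d" "phase_integrable \<Omega> e"
    using conv dui inf \<open>t \<in> T\<close>
    by (auto simp: a_def b_def c_def d_def e_def integrals_converge_def
        differentiable_under_integral_def no_terms_at_infinity_def)
  have diff: "f t x differentiable (at v)" if "x \<in> \<Omega>" for x v
  proof -
    have "(\<lambda>(x, v). f t x v) differentiable (at (x, v))"
      using sol \<open>t \<in> T\<close> that \<open>open \<Omega>\<close> differentiable_on_eq_differentiable_at[of "\<Omega> \<times> UNIV"]
      by (auto simp: fokker_planck_solution_def class_C01_def open_Times)
    moreover have "(\<lambda>w. (x, w)) differentiable (at v)"
      by (intro differentiableI[where f' = "\<lambda>w. (0, w)"] derivative_eq_intros) auto
    ultimately show ?thesis
      using differentiable_chain_at[of "\<lambda>w. (x, w)" v "\<lambda>(x, v). f t x v"] by (simp add: o_def)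
  qed
  have diff2: "(\<lambda>s. partial_deriv i (f t x) (v + s *\<^sub>R axis i 1)) differentiable (at 0)"
    if "x \<in> \<Omega>" for x v i
    using sol that \<open>t \<in> T\<close> by (auto simp: fokker_planck_solution_def)
  \<comment> \<open>The equation times the multiplier, with the transport terms on the left.\<close>
  have equation: "a x v + b x v + (d x v + e x v) = (\<Sum>i\<in>UNIV. c i x v)" if x: "x \<in> \<Omega>" for x v
  proof -
    have "b x v = (ln (f t x v / (1 + k * f t x v)) + 1) * time_deriv T f t x v"
      unfolding b_def using sol \<open>t \<in> T\<close> x pos[OF x] \<open>k \<noteq> 0\<close>
      by (intro time_deriv_Phi) (auto simp: fokker_planck_solution_def)
    then have "a x v + b x v + (d x v + e x v) = multiplier k (f t x) v *
        (time_deriv T f t x v + v \<bullet> grad (\<lambda>y. f t y v) x)"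
      by (simp add: a_def d_def e_def multiplier_def algebra_simps)
    also have "time_deriv T f t x v + v \<bullet> grad (\<lambda>y. f t y v) x =
        divergence (velocity_current k (f t x)) v"
      using sol \<open>t \<in> T\<close> x divergence_velocity_current[OF diff[OF x] diff2[OF x]]
      by (simp add: fokker_planck_solution_def)
    finally show ?thesis
      by (simp add: c_def divergence_def sum_distrib_left)
  qed
  have c: "phase_integral \<Omega> (c i) \<le> 0" for i
    unfolding c_def using inf
    by (intro phase_integral_nonpos integral_multiplier_divergence_current_nonpos pos diff diff2)
      (auto simp: no_terms_at_infinity_def Let_def)
  have "phase_integral \<Omega> a + phase_integral \<Omega> b + (phase_integral \<Omega> d + phase_integral \<Omega> e) =
      phase_integral \<Omega> (\<lambda>x v. a x v + b x v + (d x v + e x v))"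
    using int by (simp add: phase_integral_add phase_integrable_add)
  also have "\<dots> = phase_integral \<Omega> (\<lambda>x v. \<Sum>i\<in>UNIV. c i x v)"
    by (intro phase_integral_cong equation)
  also have "\<dots> = (\<Sum>i\<in>UNIV. phase_integral \<Omega> (c i))"
    using phase_integral_sum[of UNIV \<Omega> c] int(3) by simp
  also have "\<dots> \<le> 0"
    by (intro sum_nonpos c)
  finally show ?thesis
    using flux by (simp add: a_def b_def d_def e_def energy_flux_def entropy_flow_def)
qed

lemma free_energy_nondecreasing:
  assumes "open \<Omega>" "k \<noteq> 0" "(T, f) \<in> dissipative_class k \<Omega>"
    and t: "t\<^sub>0 \<in> T" "t \<in> T" "t\<^sub>0 \<le> t"
  shows "free_energy k \<Omega> (f t\<^sub>0) \<le> free_energy k \<Omega> (f t)"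
proof -
  let ?F = "\<lambda>s. entropy k \<Omega> (f s) - energy \<Omega> (f s)"
  let ?D = "\<lambda>s. - phase_integral \<Omega> (time_deriv T (\<lambda>s x v. Phi k (f s x v)) s) -
    phase_integral \<Omega> (\<lambda>x v. (norm v)\<^sup>2 / 2 * time_deriv T f s x v)"
  have conv: "integrals_converge k \<Omega> (f s)" if "s \<in> T" for s
    using assms(3) that by (auto simp: dissipative_class_def)
  have F: "free_energy k \<Omega> (f s) = ?F s" if "s \<in> T" for s
    using conv[OF that] by (intro free_energy_eq_entropy_minus_energy)
      (auto simp: integrals_converge_def)
  have sub: "{t\<^sub>0..t} \<subseteq> T"
  proof -
    have "is_interval T"
      using assms(3) by (simp add: dissipative_class_def fokker_planck_solution_def)
    with t show ?thesis
      using mem_is_interval_1_I[of T t\<^sub>0 t] by auto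
  qed
  have "(?F has_derivative (*) (?D s)) (at s within {t\<^sub>0..t})" if "t\<^sub>0 \<le> s" "s \<le> t" for s
  proof -
    have "(?F has_real_derivative ?D s) (at s within T)"
      using assms(3) sub that
      by (intro DERIV_diff) (auto simp: dissipative_class_def differentiable_under_integral_def)
    then show ?thesis
      using sub by (auto simp: has_field_derivative_def intro: has_derivative_subset)
  qed
  from mvt_very_simple[OF t(3) this] obtain s where s: "s \<in> {t\<^sub>0..t}"
    "?F t - ?F t\<^sub>0 = ?D s * (t - t\<^sub>0)"
    by blast
  moreover have "0 \<le> ?D s"
    using free_energy_dissipation[OF assms(1-3), of s] s(1) sub by auto
  ultimately have "?F t\<^sub>0 \<le> ?F t"
    using t(3) mult_nonneg_nonneg[of "?D s" "t - t\<^sub>0"] by linarith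
  then show ?thesis
    using F t by simp
qed


section \<open>Stability\<close>

theorem theorem4p3:
  fixes k :: real and \<Omega> :: "(real ^ 'n) set" and M :: "real ^ 'n \<Rightarrow> real ^ 'n \<Rightarrow> real"
  assumes "open \<Omega>" and "connected \<Omega>" and "\<Omega> \<noteq> {}" and "bounded \<Omega>"
    and "gauss_regular \<Omega>"
    and "k < 0 \<or> (0 < k \<and> k < 1)"
    and "global_maxwellian k M"
    and "free_energy k \<Omega> M = max_free_energy k \<Omega>"
  shows "lyapunov_stable (free_energy_gap k \<Omega> M) (dissipative_class k \<Omega>)"
  unfolding lyapunov_stable_def
proof (intro allI impI)
  fix \<epsilon> :: real
  assume "0 < \<epsilon>"
  have gap: "free_energy_gap k \<Omega> M (f t) \<le> free_energy_gap k \<Omega> M (f t\<^sub>0)"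
    if "(T, f) \<in> dissipative_class k \<Omega>" "t\<^sub>0 \<in> T" "t \<in> T" "t\<^sub>0 < t" for T f t\<^sub>0 t
    using free_energy_nondecreasing[OF \<open>open \<Omega>\<close> _ that(1-3)] that(4) assms(6)
    by (auto simp: free_energy_gap_def)
  show "\<exists>\<delta>>0. \<forall>(T, f)\<in>dissipative_class k \<Omega>. \<forall>t\<^sub>0\<in>T. free_energy_gap k \<Omega> M (f t\<^sub>0) < \<delta> \<longrightarrow>
      (\<forall>t\<in>T. t > t\<^sub>0 \<longrightarrow> free_energy_gap k \<Omega> M (f t) < \<epsilon>)"
  proof (intro exI[of _ \<epsilon>] conjI \<open>0 < \<epsilon>\<close> ballI, clarify)
    fix T f t\<^sub>0 t
    assume "(T, f) \<in> dissipative_class k \<Omega>" "t\<^sub>0 \<in> T" "t \<in> T" "t\<^sub>0 < t"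
      and "free_energy_gap k \<Omega> M (f t\<^sub>0) < \<epsilon>"
    then show "free_energy_gap k \<Omega> M (f t) < \<epsilon>"
      using gap[of T f t\<^sub>0 t] by linarith
  qed
qed

end
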